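(* Let $d,d'\ge1$, $t_f>0$, $F:\mathbb{R}^d\to\mathbb{R}^d$ be $C^2$, $A:\mathbb{R}^d\to\mathcal{S}^{d'}_{++}$ be $C^3$ with $A(r)\succeq C^{-1}I$ for all $r$, $b:\mathbb{R}^d\to\mathbb{R}^{d'}$ be $C^3$, and $Q(r,x)=\tfrac12x^\top A(r)x-b(r)^\top x$. For $\varepsilon>0$ let $(r_\varepsilon,x_\varepsilon)$ solve the XLMD system $$\ddot r_\varepsilon=F(r_\varepsilon)-\frac{\partial Q}{\partial r}(r_\varepsilon,x_\varepsilon),\qquad \varepsilon\ddot x_\varepsilon=b(r_\varepsilon)-A(r_\varepsilon)x_\varepsilon$$ on $[0,t_f]$, with $r_\varepsilon,x_\varepsilon$ of class $C^3$ and $|r_\varepsilon|,|\dot r_\varepsilon|,|\ddot r_\varepsilon|,|x_\varepsilon|,\sqrt\varepsilon|\dot x_\varepsilon|\le C$ on $[0,t_f]$ with $C$ independent of $\varepsilon$, and with compatible initial condition $x_\varepsilon(0)=A(r_\varepsilon(0))^{-1}b(r_\varepsilon(0))$, $\dot x_\varepsilon(0)$ bounded uniformly in $\varepsilon$ (and $r_\varepsilon(0),\dot r_\varepsilon(0)$ bounded uniformly in $\varepsilon$). Define $y_\varepsilon:=x_\varepsilon-A(r_\varepsilon)^{-1}b(r_\varepsilon)$, which solves $\varepsilon\ddot y_\varepsilon=-A(r_\varepsilon)y_\varepsilon+\varepsilon\psi_\varepsilon$ with $\psi_\varepsilon=-\frac{d^2}{dt^2}[A(r_\varepsilon)^{-1}b(r_\varepsilon)]$,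 $y_\varepsilon(0)=0$. Then $|y_\varepsilon(t)|\le C\varepsilon^{1/2}$ and $|\dot y_\varepsilon(t)|\le C$ for all $t\in[0,t_f]$, with $C$ independent of $\varepsilon$.
   Context: $\mathcal{S}^{d'}_{++}$ is the set of real symmetric positive definite $d'\times d'$ matrices; $\frac{\partial Q}{\partial r}$ is the gradient of $Q$ in $r$. Constants may depend on $t_f$ and the data but not on $\varepsilon$. *)

theory Defs
  imports "HOL-Analysis.Analysis"
begin

text \<open>k-times continuously (Frechet) differentiable on the whole space.
  C^0 = continuous; C^(k+1) = differentiable everywhere and every
  directional derivative x \<mapsto> Df(x)v is C^k (on a finite-dimensional
  domain this is exactly C^(k+1)).\<close>
primrec Ck :: "nat \<Rightarrow> ('a::euclidean_space \<Rightarrow> 'b::real_normed_vector) \<Rightarrow> bool" where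
  "Ck 0 f = continuous_on UNIV f"
| "Ck (Suc k) f = (f differentiable_on UNIV \<and>
      (\<forall>v. Ck k (\<lambda>x. frechet_derivative f (at x) v)))"

text \<open>Q(r,x) = 1/2 x^T A(r) x - b(r)^T x\<close>
definition Qfun :: "(real^'d \<Rightarrow> real^'m^'m) \<Rightarrow> (real^'d \<Rightarrow> real^'m)
    \<Rightarrow> real^'d \<Rightarrow> real^'m \<Rightarrow> real" where
  "Qfun A b r x = (1/2) * (x \<bullet> (A r *v x)) - b r \<bullet> x"

text \<open>Gradient of Q in r.\<close>
definition gradQ_r :: "(real^'d \<Rightarrow> real^'m^'m) \<Rightarrow> (real^'d \<Rightarrow> real^'m)
    \<Rightarrow> real^'d \<Rightarrow> real^'m \<Rightarrow> real^'d" where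
  "gradQ_r A b r x = (\<chi> i. frechet_derivative (\<lambda>\<rho>. Qfun A b \<rho> x) (at r) (axis i 1))"

end

theory Submission
  imports Defs
begin

(* The deviation y = x - g of the fast variable from its quasi-static value g = A(r)^-1 b(r) solves
   eps y'' = -A(r) y - eps g''. Since r, r', r'' are bounded, A and b are C^2 and A is uniformly
   coercive, the curves A(r), b(r) and hence g have first and second derivatives bounded
   independently of eps. The energy E = eps/2 |y'|^2 + 1/2 y.A(r)y satisfies
   E' = -eps y'.g'' + 1/2 y.(A(r))'y <= eps |g''|^2/2 + (1 + L C) E, and E(0) = eps/2 |y'(0)|^2 = O(eps)
   because y(0) = 0. Gronwall's inequality gives E = O(eps) on [0,tf], so |y| = O(sqrt eps) by
   coercivity and |y'| = O(1). *)

subsection \<open>Matrices bounded below\<close>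

lemma norm_matrix_vector_mult_le:
  fixes M :: "real^'n^'m"
  shows "norm (M *v v) \<le> norm M * norm v"
proof -
  have "norm (M *v v) = L2_set (\<lambda>i. \<bar>M $ i \<bullet> v\<bar>) UNIV"
    by (simp add: norm_vec_def matrix_mult_dot)
  also have "\<dots> \<le> L2_set (\<lambda>i. norm (M $ i) * norm v) UNIV"
    by (rule L2_set_mono) (simp_all add: Cauchy_Schwarz_ineq2)
  also have "\<dots> = norm M * norm v"
    by (simp add: L2_set_left_distrib norm_vec_def)
  finally show ?thesis .
qed

lemma bounded_bilinear_matrix_vector_mult:
  "bounded_bilinear ((*v) :: real^'n^'m \<Rightarrow> real^'n \<Rightarrow> real^'m)"
proof
  show "\<exists>K. \<forall>(M :: real^'n^'m) v. norm (M *v v) \<le> norm M * norm v * K"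
    by (rule exI[of _ 1]) (simp add: norm_matrix_vector_mult_le)
qed (simp_all add: matrix_vector_mult_add_rdistrib matrix_vector_right_distrib
       matrix_vector_mult_scaleR scaleR_matrix_vector_assoc[symmetric])

lemma coercive_imp_bounded_below:
  fixes M :: "real^'m^'m"
  assumes "c * norm v ^ 2 \<le> v \<bullet> (M *v v)"
  shows "c * norm v \<le> norm (M *v v)"
proof (cases "v = 0")
  case False
  have "norm v * (c * norm v) \<le> norm v * norm (M *v v)"
    using order_trans[OF assms norm_cauchy_schwarz] by (simp add: power2_eq_square algebra_simps)
  then show ?thesis using False by simp
qed simp

lemma
  fixes M :: "real^'m^'m"
  assumes c: "c > 0" and below: "\<And>u. c * norm u \<le> norm (M *v u)"
  shows matrix_inv_right_bounded_below: "M *v (matrix_inv M *v w) = w"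
    and norm_matrix_inv_bounded_below: "norm (matrix_inv M *v w) \<le> norm w / c"
proof -
  have "\<forall>u. M *v u = 0 \<longrightarrow> u = 0"
    using below c by (metis mult_le_0_iff norm_le_zero_iff norm_zero not_le)
  then have "invertible M"
    using matrix_left_invertible_ker invertible_left_inverse by blast
  then have "M ** matrix_inv M = mat 1"
    unfolding invertible_def matrix_inv_def by (rule someI2_ex) blast
  then show inv: "M *v (matrix_inv M *v w) = w"
    by (simp add: matrix_vector_mul_assoc)
  show "norm (matrix_inv M *v w) \<le> norm w / c"
    using below[of "matrix_inv M *v w"] c by (simp add: inv field_simps)
qed

lemma inner_matrix_vector_mult_symmetric:
  fixes M :: "real^'m^'m"
  assumes "transpose M = M"
  shows "u \<bullet> (M *v w) = w \<bullet> (M *v u)"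
  by (metis assms dot_lmul_matrix inner_commute transpose_matrix_vector)

subsection \<open>C^2 maps along bounded curves\<close>

lemma linear_axis_expansion:
  fixes v :: "real^'n"
  assumes "linear L"
  shows "L v = (\<Sum>i\<in>UNIV. v $ i *\<^sub>R L (axis i 1))"
proof -
  have "L v = L (\<Sum>i\<in>UNIV. v $ i *\<^sub>R axis i 1)"
    using basis_expansion[of v] by (simp add: scalar_mult_eq_scaleR)
  also have "\<dots> = (\<Sum>i\<in>UNIV. v $ i *\<^sub>R L (axis i 1))"
    using assms by (simp add: linear_sum linear_scale)
  finally show ?thesis .
qed

lemma norm_linear_le_axis_bound:
  fixes v :: "real^'n"
  assumes "linear L" and "\<And>i. norm (L (axis i 1)) \<le> K"
  shows "norm (L v) \<le> real CARD('n) * K * norm v"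
proof -
  have "norm (L v) \<le> (\<Sum>i\<in>UNIV. norm (v $ i *\<^sub>R L (axis i 1)))"
    unfolding linear_axis_expansion[OF assms(1), of v] by (rule norm_sum)
  also have "\<dots> \<le> (\<Sum>i::'n\<in>UNIV. norm v * K)"
    by (intro sum_mono) (simp add: mult_mono component_le_norm_cart assms(2))
  finally show ?thesis by (simp add: mult_ac)
qed

lemma has_vector_derivative_frechet_chain:
  assumes "f differentiable (at (r t))" and "(r has_vector_derivative r') (at t within S)"
  shows "((\<lambda>s. f (r s)) has_vector_derivative frechet_derivative f (at (r t)) r') (at t within S)"
proof -
  have Df: "(f has_derivative frechet_derivative f (at (r t))) (at (r t))"
    using assms(1) frechet_derivative_works by blast
  have "((\<lambda>s. f (r s)) has_derivative (\<lambda>h. frechet_derivative f (at (r t)) (h *\<^sub>R r'))) (at t within S)"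
    using has_derivative_compose[OF assms(2)[unfolded has_vector_derivative_def] Df] .
  moreover have "(\<lambda>h. frechet_derivative f (at (r t)) (h *\<^sub>R r')) = (\<lambda>h. h *\<^sub>R frechet_derivative f (at (r t)) r')"
    using has_derivative_linear[OF Df] by (simp add: linear_scale)
  ultimately show ?thesis by (simp add: has_vector_derivative_def)
qed

lemma Ck_Suc_imp_Ck: "Ck (Suc k) f \<Longrightarrow> Ck k f"
proof (induction k arbitrary: f)
  case 0
  then show ?case by (simp add: differentiable_imp_continuous_on)
next
  case (Suc k)
  have "f differentiable_on UNIV \<and> (\<forall>v. Ck (Suc k) (\<lambda>x. frechet_derivative f (at x) v))"
    using Suc.prems by (subst (asm) Ck.simps(2))
  then show ?case
    by (subst Ck.simps(2)) (use Suc.IH in blast)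
qed

lemma
  assumes "Ck 2 f"
  shows Ck2_differentiable: "f differentiable (at \<rho>)"
    and Ck2_partial_differentiable: "(\<lambda>\<rho>. frechet_derivative f (at \<rho>) v) differentiable (at \<rho>)"
    and Ck2_second_partial_continuous:
      "continuous_on UNIV (\<lambda>\<rho>. frechet_derivative (\<lambda>\<rho>. frechet_derivative f (at \<rho>) v) (at \<rho>) w)"
  using assms by (auto simp: numeral_2_eq_2 differentiable_on_def)

lemma Ck2_partials_bounded_on_cball:
  fixes f :: "real^'d \<Rightarrow> 'b::real_normed_vector"
  assumes f: "Ck 2 f"
  obtains K where "K \<ge> 0" and "\<And>\<rho> i j. norm \<rho> \<le> B \<Longrightarrow>
      norm (f \<rho>) \<le> K \<and> norm (frechet_derivative f (at \<rho>) (axis i 1)) \<le> K \<and>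
      norm (frechet_derivative (\<lambda>\<rho>. frechet_derivative f (at \<rho>) (axis i 1)) (at \<rho>) (axis j 1)) \<le> K"
proof -
  define D where "D i \<rho> = frechet_derivative f (at \<rho>) (axis i 1)" for i \<rho>
  define D2 where "D2 i j \<rho> = frechet_derivative (D i) (at \<rho>) (axis j 1)" for i j \<rho>
  define P where "P \<rho> = norm (f \<rho>) + (\<Sum>i\<in>UNIV. norm (D i \<rho>)) + (\<Sum>i\<in>UNIV. \<Sum>j\<in>UNIV. norm (D2 i j \<rho>))"
    for \<rho>
  have "continuous_on UNIV f" "continuous_on UNIV (D i)" "continuous_on UNIV (D2 i j)" for i j
    unfolding D_def[abs_def] D2_def[abs_def]
    using Ck2_differentiable[OF f] Ck2_partial_differentiable[OF f] Ck2_second_partial_continuous[OF f]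
    by (auto intro!: continuous_at_imp_continuous_on differentiable_imp_continuous_within)
  then have "continuous_on UNIV P"
    unfolding P_def[abs_def] by (intro continuous_intros) auto
  then have "compact (P ` cball 0 B)"
    by (rule compact_continuous_image[OF continuous_on_subset]) auto
  then obtain K where K0: "\<forall>p \<in> P ` cball 0 B. norm p \<le> K"
    using compact_imp_bounded bounded_iff by blast
  have K: "P \<rho> \<le> K" if "norm \<rho> \<le> B" for \<rho>
  proof -
    have "norm (P \<rho>) \<le> K"
      using K0 that by simp
    then show ?thesis by simp
  qed
  show thesis
  proof (rule that[of "max K 0"])
    fix \<rho> :: "real^'d" and i j
    assume "norm \<rho> \<le> B"
    have "norm (D i \<rho>) \<le> (\<Sum>i\<in>UNIV. norm (D i \<rho>))"
      by (rule member_le_sum) auto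
    moreover have "norm (D2 i j \<rho>) \<le> (\<Sum>i\<in>UNIV. \<Sum>j\<in>UNIV. norm (D2 i j \<rho>))"
      using member_le_sum[of i UNIV "\<lambda>i. \<Sum>j\<in>UNIV. norm (D2 i j \<rho>)"]
        member_le_sum[of j UNIV "\<lambda>j. norm (D2 i j \<rho>)"]
      by (simp add: sum_nonneg)
    moreover have "0 \<le> (\<Sum>i\<in>UNIV. norm (D i \<rho>))" "0 \<le> (\<Sum>i\<in>UNIV. \<Sum>j\<in>UNIV. norm (D2 i j \<rho>))"
      by (simp_all add: sum_nonneg)
    ultimately show "norm (f \<rho>) \<le> max K 0 \<and> norm (frechet_derivative f (at \<rho>) (axis i 1)) \<le> max K 0 \<and>
      norm (frechet_derivative (\<lambda>\<rho>. frechet_derivative f (at \<rho>) (axis i 1)) (at \<rho>) (axis j 1)) \<le> max K 0"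
      using K[OF \<open>norm \<rho> \<le> B\<close>] norm_ge_zero[of "f \<rho>"] unfolding P_def D2_def D_def by linarith
  qed simp
qed

definition bounded_twice_differentiable_on :: "real set \<Rightarrow> real \<Rightarrow> (real \<Rightarrow> 'a::real_normed_vector) \<Rightarrow> bool"
  where "bounded_twice_differentiable_on S K f \<longleftrightarrow> (\<exists>f' f''. \<forall>t\<in>S.
    (f has_vector_derivative f' t) (at t within S) \<and> (f' has_vector_derivative f'' t) (at t within S) \<and>
    norm (f t) \<le> K \<and> norm (f' t) \<le> K \<and> norm (f'' t) \<le> K)"

lemma bounded_twice_differentiable_on_mono:
  "bounded_twice_differentiable_on S K f \<Longrightarrow> K \<le> L \<Longrightarrow> bounded_twice_differentiable_on S L f"
  unfolding bounded_twice_differentiable_on_def by (meson order_trans)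

text \<open>The sum is D^2 f(rho)(rho', rho') + Df(rho) rho'', written in the coordinate directions in
  which Ck is defined.\<close>

lemma has_vector_derivative_frechet_derivative_comp:
  fixes f :: "real^'d \<Rightarrow> 'b::real_normed_vector"
  assumes f: "Ck 2 f"
    and \<rho>: "(\<rho> has_vector_derivative \<rho>' t) (at t within S)"
    and \<rho>': "(\<rho>' has_vector_derivative \<rho>'' t) (at t within S)"
  shows "((\<lambda>s. frechet_derivative f (at (\<rho> s)) (\<rho>' s)) has_vector_derivative
    (\<Sum>i\<in>UNIV. \<rho>' t $ i *\<^sub>R frechet_derivative (\<lambda>x. frechet_derivative f (at x) (axis i 1)) (at (\<rho> t)) (\<rho>' t)
      + \<rho>'' t $ i *\<^sub>R frechet_derivative f (at (\<rho> t)) (axis i 1))) (at t within S)"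
proof -
  have "linear (frechet_derivative f (at x))" for x
    using Ck2_differentiable[OF f] frechet_derivative_works has_derivative_linear by blast
  then have "(\<lambda>s. frechet_derivative f (at (\<rho> s)) (\<rho>' s)) =
      (\<lambda>s. \<Sum>i\<in>UNIV. \<rho>' s $ i *\<^sub>R frechet_derivative f (at (\<rho> s)) (axis i 1))"
    using linear_axis_expansion by blast
  moreover have "((\<lambda>s. \<rho>' s $ i) has_real_derivative \<rho>'' t $ i) (at t within S)" for i
    using bounded_linear.has_vector_derivative[OF bounded_linear_vec_nth \<rho>']
    unfolding has_real_derivative_iff_has_vector_derivative .
  moreover have "((\<lambda>s. frechet_derivative f (at (\<rho> s)) (axis i 1)) has_vector_derivative
      frechet_derivative (\<lambda>x. frechet_derivative f (at x) (axis i 1)) (at (\<rho> t)) (\<rho>' t)) (at t within S)" for i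
    using has_vector_derivative_frechet_chain[OF Ck2_partial_differentiable[OF f] \<rho>] .
  ultimately show ?thesis
    by (auto intro!: has_vector_derivative_sum has_vector_derivative_scaleR)
qed

lemma Ck2_derivatives_bounded_on_cball:
  fixes f :: "real^'d \<Rightarrow> 'b::real_normed_vector"
  assumes f: "Ck 2 f"
  obtains K where "\<And>x u w. norm x \<le> B \<Longrightarrow> norm u \<le> B \<Longrightarrow> norm w \<le> B \<Longrightarrow>
    norm (f x) \<le> K \<and> norm (frechet_derivative f (at x) u) \<le> K \<and>
    norm (\<Sum>i\<in>UNIV. u $ i *\<^sub>R frechet_derivative (\<lambda>y. frechet_derivative f (at y) (axis i 1)) (at x) u
      + w $ i *\<^sub>R frechet_derivative f (at x) (axis i 1)) \<le> K"
proof -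
  define D where "D i x = frechet_derivative f (at x) (axis i 1)" for i x
  obtain K where "K \<ge> 0" and K: "\<And>x i j. norm x \<le> B \<Longrightarrow>
      norm (f x) \<le> K \<and> norm (D i x) \<le> K \<and> norm (frechet_derivative (D i) (at x) (axis j 1)) \<le> K"
    using Ck2_partials_bounded_on_cball[OF f, of B] unfolding D_def[abs_def] by blast
  define n where "n = real CARD('d)"
  have lin_bound: "norm (frechet_derivative g (at x) u) \<le> n * K * B"
    if "g differentiable (at x)" and "\<And>i. norm (frechet_derivative g (at x) (axis i 1)) \<le> K" and "norm u \<le> B"
    for g :: "real^'d \<Rightarrow> 'b" and x u
  proof -
    have "linear (frechet_derivative g (at x))"
      using that(1) frechet_derivative_works has_derivative_linear by blast
    then have "norm (frechet_derivative g (at x) u) \<le> n * K * norm u"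
      unfolding n_def using that(2) by (rule norm_linear_le_axis_bound)
    also have "\<dots> \<le> n * K * B"
      using that(3) \<open>0 \<le> K\<close> by (simp add: n_def mult_left_mono)
    finally show ?thesis .
  qed
  show thesis
  proof (rule that[of "K + n * K * B + n * B * (n * K * B + K)"])
    fix x u w :: "real^'d"
    assume "norm x \<le> B" "norm u \<le> B" "norm w \<le> B"
    have "0 \<le> B" "0 \<le> n"
      using \<open>norm x \<le> B\<close> norm_ge_zero[of x] unfolding n_def by linarith+
    have coord: "\<bar>u $ i\<bar> \<le> B" "\<bar>w $ i\<bar> \<le> B" for i
      using \<open>norm u \<le> B\<close> \<open>norm w \<le> B\<close> component_le_norm_cart order_trans by blast+
    have "norm (f x) \<le> K"
      using K \<open>norm x \<le> B\<close> by blast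
    have "norm (frechet_derivative f (at x) u) \<le> n * K * B"
      using Ck2_differentiable[OF f] K \<open>norm x \<le> B\<close> \<open>norm u \<le> B\<close> unfolding D_def
      by (intro lin_bound) blast+
    have "norm (\<Sum>i\<in>UNIV. u $ i *\<^sub>R frechet_derivative (D i) (at x) u + w $ i *\<^sub>R D i x)
        \<le> (\<Sum>i::'d\<in>UNIV. B * (n * K * B) + B * K)"
    proof (intro order_trans[OF norm_sum] sum_mono order_trans[OF norm_triangle_ineq] add_mono)
      fix i
      have "norm (frechet_derivative (D i) (at x) u) \<le> n * K * B"
        using Ck2_partial_differentiable[OF f] K \<open>norm x \<le> B\<close> \<open>norm u \<le> B\<close> unfolding D_def[abs_def]
        by (intro lin_bound) blast+
      then show "norm (u $ i *\<^sub>R frechet_derivative (D i) (at x) u) \<le> B * (n * K * B)"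
        using coord \<open>0 \<le> B\<close> by (auto intro!: mult_mono)
      show "norm (w $ i *\<^sub>R D i x) \<le> B * K"
        using coord K \<open>norm x \<le> B\<close> \<open>0 \<le> B\<close> by (auto intro!: mult_mono)
    qed
    also have "\<dots> = n * B * (n * K * B + K)"
      unfolding n_def by (simp add: algebra_simps)
    finally have "norm (\<Sum>i\<in>UNIV. u $ i *\<^sub>R frechet_derivative (D i) (at x) u + w $ i *\<^sub>R D i x)
        \<le> n * B * (n * K * B + K)" .
    moreover have "0 \<le> n * K * B" "0 \<le> n * B * (n * K * B + K)"
      using \<open>0 \<le> n\<close> \<open>0 \<le> K\<close> \<open>0 \<le> B\<close> by simp_all
    ultimately show "norm (f x) \<le> K + n * K * B + n * B * (n * K * B + K) \<and>
        norm (frechet_derivative f (at x) u) \<le> K + n * K * B + n * B * (n * K * B + K) \<and>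
        norm (\<Sum>i\<in>UNIV. u $ i *\<^sub>R frechet_derivative (\<lambda>y. frechet_derivative f (at y) (axis i 1)) (at x) u
          + w $ i *\<^sub>R frechet_derivative f (at x) (axis i 1)) \<le> K + n * K * B + n * B * (n * K * B + K)"
      using \<open>norm (f x) \<le> K\<close> \<open>norm (frechet_derivative f (at x) u) \<le> n * K * B\<close> \<open>0 \<le> K\<close>
      unfolding D_def[abs_def] by linarith
  qed
qed

lemma bounded_twice_differentiable_on_Ck2_comp:
  fixes f :: "real^'d \<Rightarrow> 'b::real_normed_vector"
  assumes f: "Ck 2 f"
  obtains K where "\<And>\<rho> S. bounded_twice_differentiable_on S B \<rho> \<Longrightarrow>
    bounded_twice_differentiable_on S K (\<lambda>s. f (\<rho> s))"
proof -
  obtain K where K: "\<And>x u w. norm x \<le> B \<Longrightarrow> norm u \<le> B \<Longrightarrow> norm w \<le> B \<Longrightarrow>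
    norm (f x) \<le> K \<and> norm (frechet_derivative f (at x) u) \<le> K \<and>
    norm (\<Sum>i\<in>UNIV. u $ i *\<^sub>R frechet_derivative (\<lambda>y. frechet_derivative f (at y) (axis i 1)) (at x) u
      + w $ i *\<^sub>R frechet_derivative f (at x) (axis i 1)) \<le> K"
    using Ck2_derivatives_bounded_on_cball[OF f] by blast
  show thesis
  proof (rule that[of K])
    fix \<rho> :: "real \<Rightarrow> real^'d" and S
    assume "bounded_twice_differentiable_on S B \<rho>"
    then obtain \<rho>' \<rho>'' where \<rho>: "\<And>t. t \<in> S \<Longrightarrow>
        (\<rho> has_vector_derivative \<rho>' t) (at t within S) \<and> (\<rho>' has_vector_derivative \<rho>'' t) (at t within S) \<and>
        norm (\<rho> t) \<le> B \<and> norm (\<rho>' t) \<le> B \<and> norm (\<rho>'' t) \<le> B"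
      unfolding bounded_twice_differentiable_on_def by blast
    define f' where "f' t = frechet_derivative f (at (\<rho> t)) (\<rho>' t)" for t
    define f'' where "f'' t = (\<Sum>i\<in>UNIV. \<rho>' t $ i *\<^sub>R
        frechet_derivative (\<lambda>y. frechet_derivative f (at y) (axis i 1)) (at (\<rho> t)) (\<rho>' t)
      + \<rho>'' t $ i *\<^sub>R frechet_derivative f (at (\<rho> t)) (axis i 1))" for t
    show "bounded_twice_differentiable_on S K (\<lambda>s. f (\<rho> s))"
      unfolding bounded_twice_differentiable_on_def
    proof (intro exI ballI conjI)
      fix t assume "t \<in> S"
      show "((\<lambda>s. f (\<rho> s)) has_vector_derivative f' t) (at t within S)"
        unfolding f'_def using has_vector_derivative_frechet_chain[OF Ck2_differentiable[OF f]] \<rho> \<open>t \<in> S\<close> by blast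
      show "(f' has_vector_derivative f'' t) (at t within S)"
        unfolding f'_def[abs_def] f''_def using has_vector_derivative_frechet_derivative_comp[OF f] \<rho> \<open>t \<in> S\<close>
        by blast
      show "norm (f (\<rho> t)) \<le> K" "norm (f' t) \<le> K" "norm (f'' t) \<le> K"
        unfolding f'_def f''_def using K \<rho>[OF \<open>t \<in> S\<close>] by blast+
    qed
  qed
qed

subsection \<open>The quasi-static state\<close>

lemma has_vector_derivative_matrix_inv_mult:
  fixes M :: "real \<Rightarrow> real^'m^'m" and v :: "real \<Rightarrow> real^'m"
  assumes c: "c > 0" and below: "\<And>s u. s \<in> S \<Longrightarrow> c * norm u \<le> norm (M s *v u)" and "t \<in> S"
    and M: "(M has_vector_derivative M') (at t within S)"
    and v: "(v has_vector_derivative v') (at t within S)"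
  shows "((\<lambda>s. matrix_inv (M s) *v v s) has_vector_derivative
           matrix_inv (M t) *v (v' - M' *v (matrix_inv (M t) *v v t))) (at t within S)"
proof -
  define h where "h s = matrix_inv (M s) *v v s" for s
  define w where "w = matrix_inv (M t) *v (v' - M' *v h t)"
  define q where "q s = (1 / norm (s - t)) *\<^sub>R (h s - (h t + (s - t) *\<^sub>R w))" for s
  define qv where "qv s = (1 / norm (s - t)) *\<^sub>R (v s - (v t + (s - t) *\<^sub>R v'))" for s
  define qM where "qM s = (1 / norm (s - t)) *\<^sub>R (M s - (M t + (s - t) *\<^sub>R M'))" for s
  have Mh: "M s *v h s = v s" if "s \<in> S" for s
    unfolding h_def using matrix_inv_right_bounded_below[OF c below[OF that]] .
  have Mw: "v' = M' *v h t + M t *v w"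
    unfolding w_def using matrix_inv_right_bounded_below[OF c below[OF \<open>t \<in> S\<close>]] by simp
  have "(qv \<longlongrightarrow> 0) (at t within S)" "(qM \<longlongrightarrow> 0) (at t within S)"
    using v M unfolding qv_def[abs_def] qM_def[abs_def] has_vector_derivative_def has_derivative_within
    by simp_all
  moreover have "(M \<longlongrightarrow> M t) (at t within S)"
    using M has_vector_derivative_continuous continuous_within by blast
  ultimately have bound_lim: "((\<lambda>s. (norm (qv s) + norm (qM s) * norm (h t) + norm (M s - M t) * norm w) / c)
      \<longlongrightarrow> 0) (at t within S)"
    using c by (auto intro!: tendsto_eq_intros)
  have "(q \<longlongrightarrow> 0) (at t within S)"
  proof (rule Lim_null_comparison[OF _ bound_lim])
    show "\<forall>\<^sub>F s in at t within S.
        norm (q s) \<le> (norm (qv s) + norm (qM s) * norm (h t) + norm (M s - M t) * norm w) / c"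
      unfolding eventually_at_filter
    proof (intro always_eventually allI impI)
      fix s assume "s \<noteq> t" "s \<in> S"
      txt \<open>Applying M s to the remainder of h expresses it through the remainders of v and M.\<close>
      define d where "d = norm (s - t)"
      have "d > 0" "\<bar>s - t\<bar> = d" using \<open>s \<noteq> t\<close> by (simp_all add: d_def)
      have "M s *v (d *\<^sub>R q s) = d *\<^sub>R qv s - (d *\<^sub>R qM s) *v h t - (s - t) *\<^sub>R ((M s - M t) *v w)"
        using \<open>d > 0\<close> \<open>\<bar>s - t\<bar> = d\<close> Mh[OF \<open>s \<in> S\<close>] Mh[OF \<open>t \<in> S\<close>] Mw
        by (simp add: q_def qv_def qM_def algebra_simps matrix_vector_mult_diff_distrib
            matrix_vector_mult_scaleR scaleR_matrix_vector_assoc)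
      then have "d * (c * norm (q s)) \<le>
          norm (d *\<^sub>R qv s) + norm ((d *\<^sub>R qM s) *v h t) + norm ((s - t) *\<^sub>R ((M s - M t) *v w))"
        using below[OF \<open>s \<in> S\<close>, of "d *\<^sub>R q s"] \<open>d > 0\<close>
        by (smt (verit) mult.left_commute norm_scaleR norm_triangle_ineq4 real_norm_def)
      also have "\<dots> \<le> d * norm (qv s) + d * (norm (qM s) * norm (h t)) + d * (norm (M s - M t) * norm w)"
        using norm_matrix_vector_mult_le[of "d *\<^sub>R qM s" "h t"] norm_matrix_vector_mult_le[of "M s - M t" w]
          \<open>d > 0\<close> by (intro add_mono) (auto simp: d_def mult.assoc intro: mult_left_mono)
      finally have "c * norm (q s) \<le> norm (qv s) + norm (qM s) * norm (h t) + norm (M s - M t) * norm w"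
        using \<open>d > 0\<close> by (simp add: distrib_left[symmetric])
      then show "norm (q s) \<le> (norm (qv s) + norm (qM s) * norm (h t) + norm (M s - M t) * norm w) / c"
        using c by (simp add: field_simps)
    qed
  qed
  then show ?thesis
    unfolding has_vector_derivative_def has_derivative_within q_def h_def[symmetric] w_def[symmetric]
    by (simp add: bounded_linear_scaleR_left)
qed

lemma norm_derivatives_of_solution_le:
  fixes M M' M'' :: "real^'m^'m" and v v' v'' g g' g'' :: "real^'m"
  assumes c: "c > 0" and below: "\<And>u. c * norm u \<le> norm (M *v u)"
    and bounds: "norm M' \<le> K" "norm M'' \<le> K" "norm v \<le> K" "norm v' \<le> K" "norm v'' \<le> K"
    and g: "M *v g = v" and g': "M *v g' = v' - M' *v g"
    and g'': "M *v g'' = v'' - 2 *\<^sub>R (M' *v g') - M'' *v g"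
  shows "norm g \<le> K / c" and "norm g' \<le> K / c * (1 + K / c)"
    and "norm g'' \<le> K / c * (1 + K / c) * (1 + 2 * (K / c))"
proof -
  have sol: "norm u \<le> B / c" if "M *v u = w" "norm w \<le> B" for u w B
    using below[of u] that c by (simp add: field_simps)
  have mv: "norm (A *v u) \<le> K * B" if "norm A \<le> K" "norm u \<le> B" for A :: "real^'m^'m" and u B
    using norm_matrix_vector_mult_le[of A u] that by (meson mult_mono norm_ge_zero order_trans)
  define q where "q = K / c"
  show g_le: "norm g \<le> q"
    unfolding q_def using sol[OF g] bounds by blast
  have "norm (v' - M' *v g) \<le> K + K * q"
    using norm_triangle_ineq4[of v' "M' *v g"] mv[OF _ g_le] bounds by fastforce
  then have "norm g' \<le> (K + K * q) / c"
    using sol[OF g'] by blast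
  also have "\<dots> = q * (1 + q)"
    using c by (simp add: q_def field_simps)
  finally show g'_le: "norm g' \<le> q * (1 + q)" .
  have "norm (v'' - 2 *\<^sub>R (M' *v g') - M'' *v g) \<le> K + 2 * (K * (q * (1 + q))) + K * q"
    using norm_triangle_ineq4[of "v'' - 2 *\<^sub>R (M' *v g')" "M'' *v g"]
      norm_triangle_ineq4[of v'' "2 *\<^sub>R (M' *v g')"] mv[OF _ g'_le] mv[OF _ g_le] bounds
    by fastforce
  then have "norm g'' \<le> (K + 2 * (K * (q * (1 + q))) + K * q) / c"
    using sol[OF g''] by blast
  also have "\<dots> = q * (1 + q) * (1 + 2 * q)"
    using c by (simp add: q_def field_simps)
  finally show "norm g'' \<le> q * (1 + q) * (1 + 2 * q)" .
qed

lemma bounded_twice_differentiable_on_matrix_inv_mult: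
  fixes M :: "real \<Rightarrow> real^'m^'m" and v :: "real \<Rightarrow> real^'m"
  assumes c: "c > 0" and below: "\<And>s u. s \<in> S \<Longrightarrow> c * norm u \<le> norm (M s *v u)"
    and "bounded_twice_differentiable_on S K M" and "bounded_twice_differentiable_on S K v"
  shows "bounded_twice_differentiable_on S (K / c * (1 + K / c) * (1 + 2 * (K / c)))
    (\<lambda>s. matrix_inv (M s) *v v s)"
proof -
  obtain M' M'' where M: "\<And>t. t \<in> S \<Longrightarrow>
      (M has_vector_derivative M' t) (at t within S) \<and> (M' has_vector_derivative M'' t) (at t within S) \<and>
      norm (M t) \<le> K \<and> norm (M' t) \<le> K \<and> norm (M'' t) \<le> K"
    using assms(3) unfolding bounded_twice_differentiable_on_def by blast
  obtain v' v'' where v: "\<And>t. t \<in> S \<Longrightarrow>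
      (v has_vector_derivative v' t) (at t within S) \<and> (v' has_vector_derivative v'' t) (at t within S) \<and>
      norm (v t) \<le> K \<and> norm (v' t) \<le> K \<and> norm (v'' t) \<le> K"
    using assms(4) unfolding bounded_twice_differentiable_on_def by blast
  define g where "g s = matrix_inv (M s) *v v s" for s
  define g' where "g' s = matrix_inv (M s) *v (v' s - M' s *v g s)" for s
  define g'' where "g'' s = matrix_inv (M s) *v (v'' s - (M' s *v g' s + M'' s *v g s) - M' s *v g' s)" for s
  have dg: "(g has_vector_derivative g' t) (at t within S)" if "t \<in> S" for t
    unfolding g_def[abs_def] g'_def g_def
    using has_vector_derivative_matrix_inv_mult[where M = M, OF c below that] M[OF that] v[OF that] by blast
  have dg': "(g' has_vector_derivative g'' t) (at t within S)" if "t \<in> S" for t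
  proof -
    have "((\<lambda>s. v' s - M' s *v g s) has_vector_derivative v'' t - (M' t *v g' t + M'' t *v g t)) (at t within S)"
      using bounded_bilinear.has_vector_derivative[OF bounded_bilinear_matrix_vector_mult] M[OF that] v[OF that] dg[OF that]
      by (intro has_vector_derivative_diff) auto
    then have "(g' has_vector_derivative matrix_inv (M t) *v (v'' t - (M' t *v g' t + M'' t *v g t)
        - M' t *v (matrix_inv (M t) *v (v' t - M' t *v g t)))) (at t within S)"
      unfolding g'_def[abs_def]
      using has_vector_derivative_matrix_inv_mult[where M = M, OF c below that] M[OF that] by blast
    then show ?thesis
      unfolding g''_def g'_def .
  qed
  show ?thesis
    unfolding bounded_twice_differentiable_on_def
  proof (intro exI ballI)
    fix t assume "t \<in> S"
    have "M t *v (matrix_inv (M t) *v w) = w" for w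
      using matrix_inv_right_bounded_below[OF c below[OF \<open>t \<in> S\<close>]] .
    then have "M t *v g t = v t" "M t *v g' t = v' t - M' t *v g t"
      "M t *v g'' t = v'' t - 2 *\<^sub>R (M' t *v g' t) - M'' t *v g t"
      unfolding g_def g'_def g''_def by (simp_all add: algebra_simps scaleR_2)
    note bounds = norm_derivatives_of_solution_le[where K = K, OF c below[OF \<open>t \<in> S\<close>] _ _ _ _ _ this]
    define q where "q = K / c"
    have "0 \<le> q"
      unfolding q_def using M[OF \<open>t \<in> S\<close>] norm_ge_zero[of "M t"] c by (meson divide_nonneg_pos order_trans)
    then have "q * 1 * 1 \<le> q * (1 + q) * (1 + 2 * q)" and "q * (1 + q) * 1 \<le> q * (1 + q) * (1 + 2 * q)"
      by (intro mult_mono; simp)+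
    then show "((\<lambda>s. matrix_inv (M s) *v v s) has_vector_derivative g' t) (at t within S) \<and>
        (g' has_vector_derivative g'' t) (at t within S) \<and>
        norm (matrix_inv (M t) *v v t) \<le> K / c * (1 + K / c) * (1 + 2 * (K / c)) \<and>
        norm (g' t) \<le> K / c * (1 + K / c) * (1 + 2 * (K / c)) \<and>
        norm (g'' t) \<le> K / c * (1 + K / c) * (1 + 2 * (K / c))"
      using dg dg' \<open>t \<in> S\<close> bounds M[OF \<open>t \<in> S\<close>] v[OF \<open>t \<in> S\<close>] unfolding g_def[abs_def] q_def by force
  qed
qed

subsection \<open>Energy estimate\<close>

lemma gronwall_linear:
  fixes E E' :: "real \<Rightarrow> real"
  assumes "\<beta> > 0"
    and E: "\<And>s. s \<in> {0..T} \<Longrightarrow> (E has_real_derivative E' s) (at s within {0..T})"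
    and E'_le: "\<And>s. s \<in> {0..T} \<Longrightarrow> E' s \<le> \<alpha> + \<beta> * E s"
    and t: "t \<in> {0..T}"
  shows "E t + \<alpha> / \<beta> \<le> exp (\<beta> * t) * (E 0 + \<alpha> / \<beta>)"
proof -
  define W where "W s = exp (- \<beta> * s) * (E s + \<alpha> / \<beta>)" for s
  have dW: "(W has_real_derivative exp (- \<beta> * s) * (E' s - (\<alpha> + \<beta> * E s))) (at s within {0..T})"
    if "s \<in> {0..T}" for s
    unfolding W_def[abs_def] using E[OF that] \<open>\<beta> > 0\<close>
    by (auto intro!: derivative_eq_intros simp: field_simps)
  have "W t \<le> W 0"
  proof (rule DERIV_nonpos_imp_decreasing_open[of 0 t W])
    show "0 \<le> t" using t by simp
    fix s assume "0 < s" "s < t"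
    then have "s \<in> {0..T}" "at s within {0..T} = at s"
      using t by (auto intro!: at_within_Icc_at)
    moreover have "exp (- \<beta> * s) * (E' s - (\<alpha> + \<beta> * E s)) \<le> 0"
      using E'_le[OF \<open>s \<in> {0..T}\<close>] by (simp add: mult_nonneg_nonpos)
    ultimately show "\<exists>y. DERIV W s :> y \<and> y \<le> 0"
      using dW by metis
  next
    have "continuous_on {0..T} W"
      using dW DERIV_continuous continuous_on_eq_continuous_within by blast
    then show "continuous_on {0..t} W"
      by (rule continuous_on_subset) (use t in auto)
  qed
  have "E t + \<alpha> / \<beta> = exp (\<beta> * t) * W t"
    unfolding W_def by (simp add: exp_minus field_simps)
  also have "\<dots> \<le> exp (\<beta> * t) * W 0"
    using \<open>W t \<le> W 0\<close> by simp
  also have "\<dots> = exp (\<beta> * t) * (E 0 + \<alpha> / \<beta>)"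
    by (simp add: W_def)
  finally show ?thesis .
qed

definition energy :: "real \<Rightarrow> (real \<Rightarrow> real^'m^'m) \<Rightarrow> (real \<Rightarrow> real^'m) \<Rightarrow> (real \<Rightarrow> real^'m) \<Rightarrow> real \<Rightarrow> real"
  where "energy eps M y y' s = eps / 2 * norm (y' s) ^ 2 + 1 / 2 * (y s \<bullet> (M s *v y s))"

lemma energy_lower_bounds:
  assumes "eps > 0" "C > 0" and coercive: "\<And>u. (1 / C) * norm u ^ 2 \<le> u \<bullet> (M s *v u)"
  shows "eps / 2 * norm (y' s) ^ 2 \<le> energy eps M y y' s"
    and "norm (y s) ^ 2 / (2 * C) \<le> energy eps M y y' s"
proof -
  have "norm (y s) ^ 2 / (2 * C) \<le> 1 / 2 * (y s \<bullet> (M s *v y s))"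
    using coercive[of "y s"] by simp
  moreover have "0 \<le> norm (y s) ^ 2 / (2 * C)" "0 \<le> eps / 2 * norm (y' s) ^ 2"
    using assms(1,2) by simp_all
  ultimately show "eps / 2 * norm (y' s) ^ 2 \<le> energy eps M y y' s"
    and "norm (y s) ^ 2 / (2 * C) \<le> energy eps M y y' s"
    unfolding energy_def by linarith+
qed

lemma has_real_derivative_energy:
  fixes M :: "real \<Rightarrow> real^'m^'m" and y y' :: "real \<Rightarrow> real^'m"
  assumes "eps > 0"
    and M: "(M has_vector_derivative M') (at s within S)"
    and y: "(y has_vector_derivative y' s) (at s within S)"
    and y': "(y' has_vector_derivative y'') (at s within S)"
    and sym: "transpose (M s) = M s"
    and ode: "eps *\<^sub>R y'' = eps *\<^sub>R \<phi> - M s *v y s"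
  shows "(energy eps M y y' has_real_derivative eps * (y' s \<bullet> \<phi>) + 1 / 2 * (y s \<bullet> (M' *v y s)))
    (at s within S)"
proof -
  have "(energy eps M y y' has_real_derivative eps / 2 * (y' s \<bullet> y'' + y'' \<bullet> y' s)
      + 1 / 2 * (y s \<bullet> (M s *v y' s + M' *v y s) + y' s \<bullet> (M s *v y s))) (at s within S)"
    unfolding energy_def[abs_def] power2_norm_eq_inner has_real_derivative_iff_has_vector_derivative
    using M y y'
    by (auto intro!: derivative_eq_intros
        bounded_bilinear.has_vector_derivative[OF bounded_bilinear_inner]
        bounded_bilinear.has_vector_derivative[OF bounded_bilinear_matrix_vector_mult])
  moreover have "y' s \<bullet> y'' = y' s \<bullet> \<phi> - (y' s \<bullet> (M s *v y s)) / eps"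
    using arg_cong[OF ode, of "inner (y' s)"] \<open>eps > 0\<close> by (simp add: inner_diff_right field_simps)
  moreover have "y s \<bullet> (M s *v y' s) = y' s \<bullet> (M s *v y s)"
    using inner_matrix_vector_mult_symmetric[OF sym] .
  ultimately have "eps / 2 * (y' s \<bullet> y'' + y'' \<bullet> y' s)
      + 1 / 2 * (y s \<bullet> (M s *v y' s + M' *v y s) + y' s \<bullet> (M s *v y s))
      = eps * (y' s \<bullet> \<phi>) + 1 / 2 * (y s \<bullet> (M' *v y s))"
    using \<open>eps > 0\<close> by (simp add: inner_commute[of y''] inner_add_right field_simps)
  with \<open>(energy eps M y y' has_real_derivative _) _\<close> show ?thesis
    by simp
qed

lemma energy_derivative_le:
  fixes M' :: "real^'m^'m"
  assumes "eps > 0" "C > 0" "L \<ge> 0"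
    and coercive: "\<And>u. (1 / C) * norm u ^ 2 \<le> u \<bullet> (M s *v u)"
    and "norm M' \<le> L" "norm \<phi> \<le> G"
  shows "eps * (y' s \<bullet> \<phi>) + 1 / 2 * (y s \<bullet> (M' *v y s))
    \<le> eps * G ^ 2 / 2 + (1 + L * C) * energy eps M y y' s"
proof -
  note E_ge = energy_lower_bounds[where M = M and s = s and y = y and y' = y', OF \<open>eps > 0\<close> \<open>C > 0\<close> coercive]
  have "y' s \<bullet> \<phi> \<le> norm (y' s) * norm \<phi>"
    by (rule norm_cauchy_schwarz)
  also have "\<dots> \<le> norm (y' s) * G"
    using \<open>norm \<phi> \<le> G\<close> by (simp add: mult_left_mono)
  also have "\<dots> \<le> (norm (y' s) ^ 2 + G ^ 2) / 2"
    using sum_squares_bound[of "norm (y' s)" G] by (simp add: power2_eq_square)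
  finally have "eps * (y' s \<bullet> \<phi>) \<le> eps * ((norm (y' s) ^ 2 + G ^ 2) / 2)"
    by (rule mult_left_mono) (use \<open>eps > 0\<close> in simp)
  also have "\<dots> = eps * G ^ 2 / 2 + eps / 2 * norm (y' s) ^ 2"
    by (simp add: algebra_simps)
  finally have "eps * (y' s \<bullet> \<phi>) \<le> eps * G ^ 2 / 2 + eps / 2 * norm (y' s) ^ 2" .
  moreover have "y s \<bullet> (M' *v y s) \<le> L * norm (y s) ^ 2"
  proof -
    have "y s \<bullet> (M' *v y s) \<le> norm (y s) * (norm M' * norm (y s))"
      using norm_cauchy_schwarz[of "y s" "M' *v y s"] norm_matrix_vector_mult_le[of M' "y s"]
      by (meson mult_left_mono norm_ge_zero order_trans)
    also have "\<dots> \<le> norm (y s) * (L * norm (y s))"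
      using \<open>norm M' \<le> L\<close> by (simp add: mult_left_mono mult_right_mono)
    finally show ?thesis
      by (simp add: power2_eq_square mult_ac)
  qed
  moreover have "L * norm (y s) ^ 2 \<le> L * (2 * C * energy eps M y y' s)"
    using E_ge(2) \<open>C > 0\<close> by (intro mult_left_mono \<open>L \<ge> 0\<close>) (simp add: field_simps)
  moreover have "L * (2 * C * energy eps M y y' s) = 2 * (L * C * energy eps M y y' s)"
    "(1 + L * C) * energy eps M y y' s = energy eps M y y' s + L * C * energy eps M y y' s"
    by (simp_all add: algebra_simps)
  ultimately show ?thesis
    using E_ge(1) by linarith
qed

lemma energy_estimate:
  fixes M M' :: "real \<Rightarrow> real^'m^'m" and y y' y'' \<phi> :: "real \<Rightarrow> real^'m"
  assumes "eps > 0" "C > 0" "L \<ge> 0"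
    and M: "\<And>s. s \<in> {0..T} \<Longrightarrow> (M has_vector_derivative M' s) (at s within {0..T})"
    and y: "\<And>s. s \<in> {0..T} \<Longrightarrow> (y has_vector_derivative y' s) (at s within {0..T})"
    and y': "\<And>s. s \<in> {0..T} \<Longrightarrow> (y' has_vector_derivative y'' s) (at s within {0..T})"
    and sym: "\<And>s. s \<in> {0..T} \<Longrightarrow> transpose (M s) = M s"
    and coercive: "\<And>s u. s \<in> {0..T} \<Longrightarrow> (1 / C) * norm u ^ 2 \<le> u \<bullet> (M s *v u)"
    and ode: "\<And>s. s \<in> {0..T} \<Longrightarrow> eps *\<^sub>R y'' s = eps *\<^sub>R \<phi> s - M s *v y s"
    and M'_le: "\<And>s. s \<in> {0..T} \<Longrightarrow> norm (M' s) \<le> L"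
    and \<phi>_le: "\<And>s. s \<in> {0..T} \<Longrightarrow> norm (\<phi> s) \<le> G"
    and "y 0 = 0" "norm (y' 0) \<le> Y\<^sub>0" and t: "t \<in> {0..T}"
  shows "norm (y t) ^ 2 \<le> eps * C * (exp ((1 + L * C) * T) * (Y\<^sub>0 ^ 2 + G ^ 2))"
    and "norm (y' t) ^ 2 \<le> exp ((1 + L * C) * T) * (Y\<^sub>0 ^ 2 + G ^ 2)"
proof -
  define E where "E = energy eps M y y'"
  define \<beta> where "\<beta> = 1 + L * C"
  define a where "a = eps * G ^ 2 / 2 / \<beta>"
  have E_ge: "eps / 2 * norm (y' s) ^ 2 \<le> E s" "norm (y s) ^ 2 / (2 * C) \<le> E s" if "s \<in> {0..T}" for s
    unfolding E_def using energy_lower_bounds[where M = M and s = s, OF \<open>eps > 0\<close> \<open>C > 0\<close> coercive[OF that]]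
    by auto
  have "\<beta> \<ge> 1" using \<open>L \<ge> 0\<close> \<open>C > 0\<close> by (simp add: \<beta>_def)
  then have "0 \<le> a" "a \<le> eps * G ^ 2 / 2"
    unfolding a_def using \<open>eps > 0\<close> mult_right_mono[OF \<open>\<beta> \<ge> 1\<close>, of "G ^ 2"] by (simp_all add: field_simps)
  have "E t + a \<le> exp (\<beta> * t) * (E 0 + a)"
    unfolding a_def E_def \<beta>_def
  proof (rule gronwall_linear)
    fix s assume "s \<in> {0..T}"
    show "(energy eps M y y' has_real_derivative eps * (y' s \<bullet> \<phi> s) + 1 / 2 * (y s \<bullet> (M' s *v y s)))
        (at s within {0..T})"
      using has_real_derivative_energy[OF \<open>eps > 0\<close> M y y' sym ode] \<open>s \<in> {0..T}\<close> by blast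
    show "eps * (y' s \<bullet> \<phi> s) + 1 / 2 * (y s \<bullet> (M' s *v y s))
        \<le> eps * G ^ 2 / 2 + (1 + L * C) * energy eps M y y' s"
      using \<open>s \<in> {0..T}\<close> by (intro energy_derivative_le \<open>eps > 0\<close> \<open>C > 0\<close> \<open>L \<ge> 0\<close> coercive M'_le \<phi>_le)
  qed (use \<open>\<beta> \<ge> 1\<close> t in \<open>simp_all add: \<beta>_def\<close>)
  then have "E t \<le> exp (\<beta> * t) * (E 0 + a)"
    using \<open>0 \<le> a\<close> by linarith
  also have "\<dots> \<le> exp (\<beta> * T) * (eps * (Y\<^sub>0 ^ 2 + G ^ 2) / 2)"
  proof (rule mult_mono)
    show "exp (\<beta> * t) \<le> exp (\<beta> * T)"
      using \<open>\<beta> \<ge> 1\<close> t by simp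
    have "E 0 = eps / 2 * norm (y' 0) ^ 2"
      using \<open>y 0 = 0\<close> by (simp add: E_def energy_def)
    moreover have "eps / 2 * norm (y' 0) ^ 2 \<le> eps * Y\<^sub>0 ^ 2 / 2"
      using \<open>norm (y' 0) \<le> Y\<^sub>0\<close> \<open>eps > 0\<close> by (simp add: power_mono mult_left_mono)
    moreover have "0 \<le> eps / 2 * norm (y' 0) ^ 2"
      using \<open>eps > 0\<close> by simp
    ultimately show "E 0 + a \<le> eps * (Y\<^sub>0 ^ 2 + G ^ 2) / 2" "0 \<le> E 0 + a"
      using \<open>0 \<le> a\<close> \<open>a \<le> eps * G ^ 2 / 2\<close> by (simp_all add: field_simps)
  qed simp
  finally have E_t: "2 * E t \<le> eps * (exp (\<beta> * T) * (Y\<^sub>0 ^ 2 + G ^ 2))"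
    by (simp add: field_simps)
  have "norm (y t) ^ 2 \<le> C * (2 * E t)"
    using E_ge(2)[OF t] \<open>C > 0\<close> by (simp add: field_simps)
  also have "\<dots> \<le> C * (eps * (exp (\<beta> * T) * (Y\<^sub>0 ^ 2 + G ^ 2)))"
    using E_t \<open>C > 0\<close> by simp
  finally show "norm (y t) ^ 2 \<le> eps * C * (exp ((1 + L * C) * T) * (Y\<^sub>0 ^ 2 + G ^ 2))"
    by (simp add: \<beta>_def mult_ac)
  have "eps * norm (y' t) ^ 2 \<le> eps * (exp (\<beta> * T) * (Y\<^sub>0 ^ 2 + G ^ 2))"
    using E_ge(1)[OF t] E_t by simp
  then show "norm (y' t) ^ 2 \<le> exp ((1 + L * C) * T) * (Y\<^sub>0 ^ 2 + G ^ 2)"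
    using \<open>eps > 0\<close> by (simp add: \<beta>_def)
qed

lemma quasi_static_deviation:
  fixes M :: "real \<Rightarrow> real^'m^'m" and v x x' x'' :: "real \<Rightarrow> real^'m"
    and C K G T :: real
  defines "\<Lambda> \<equiv> exp ((1 + K * C) * T) * ((C + G) ^ 2 + G ^ 2)"
  assumes "T > 0" "eps > 0" "C > 0"
    and sym: "\<And>s. s \<in> {0..T} \<Longrightarrow> transpose (M s) = M s"
    and coercive: "\<And>s u. s \<in> {0..T} \<Longrightarrow> (1 / C) * norm u ^ 2 \<le> u \<bullet> (M s *v u)"
    and M: "bounded_twice_differentiable_on {0..T} K M"
    and g: "bounded_twice_differentiable_on {0..T} G (\<lambda>s. matrix_inv (M s) *v v s)"
    and x: "\<And>s. s \<in> {0..T} \<Longrightarrow> (x has_vector_derivative x' s) (at s within {0..T})"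
    and x': "\<And>s. s \<in> {0..T} \<Longrightarrow> (x' has_vector_derivative x'' s) (at s within {0..T})"
    and ode: "\<And>s. s \<in> {0..T} \<Longrightarrow> eps *\<^sub>R x'' s = v s - M s *v x s"
    and x0: "x 0 = matrix_inv (M 0) *v v 0" "norm (x' 0) \<le> C"
    and t: "t \<in> {0..T}"
  shows "norm (x t - matrix_inv (M t) *v v t) \<le> sqrt (C * \<Lambda>) * sqrt eps"
    and "norm (vector_derivative (\<lambda>s. x s - matrix_inv (M s) *v v s) (at t within {0..T})) \<le> sqrt \<Lambda>"
proof -
  define g where "g s = matrix_inv (M s) *v v s" for s
  have below: "(1 / C) * norm u \<le> norm (M s *v u)" if "s \<in> {0..T}" for s u
    using coercive_imp_bounded_below coercive[OF that] by blast
  have Mg: "M s *v g s = v s" if "s \<in> {0..T}" for s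
    unfolding g_def by (rule matrix_inv_right_bounded_below[OF _ below[OF that]]) (use \<open>C > 0\<close> in simp)
  obtain g' g'' where g: "\<And>s. s \<in> {0..T} \<Longrightarrow>
      (g has_vector_derivative g' s) (at s within {0..T}) \<and> (g' has_vector_derivative g'' s) (at s within {0..T}) \<and>
      norm (g s) \<le> G \<and> norm (g' s) \<le> G \<and> norm (g'' s) \<le> G"
    using g unfolding g_def[symmetric] bounded_twice_differentiable_on_def by blast
  obtain M' where M': "\<And>s. s \<in> {0..T} \<Longrightarrow>
      (M has_vector_derivative M' s) (at s within {0..T}) \<and> norm (M' s) \<le> K"
    using M unfolding bounded_twice_differentiable_on_def by blast
  have "0 \<in> {0..T}" using \<open>T > 0\<close> by simp
  then have "0 \<le> K"
    using M' norm_ge_zero order_trans by blast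
  define y where "y s = x s - g s" for s
  have y: "(y has_vector_derivative x' s - g' s) (at s within {0..T})"
    and y': "((\<lambda>s. x' s - g' s) has_vector_derivative x'' s - g'' s) (at s within {0..T})"
    if "s \<in> {0..T}" for s
    unfolding y_def using x[OF that] x'[OF that] g[OF that] by (auto intro: has_vector_derivative_diff)
  have ode_y: "eps *\<^sub>R (x'' s - g'' s) = eps *\<^sub>R (- g'' s) - M s *v y s" if "s \<in> {0..T}" for s
    using ode[OF that] Mg[OF that] by (simp add: y_def matrix_vector_mult_diff_distrib scaleR_diff_right)
  have "y 0 = 0"
    using x0 by (simp add: y_def g_def)
  have "norm (x' 0 - g' 0) \<le> C + G"
    using x0 g[OF \<open>0 \<in> {0..T}\<close>] norm_triangle_ineq4[of "x' 0" "g' 0"] by linarith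
  note energy = energy_estimate[where M' = M' and \<phi> = "\<lambda>s. - g'' s" and Y\<^sub>0 = "C + G",
      OF \<open>eps > 0\<close> \<open>C > 0\<close> \<open>0 \<le> K\<close> _ y y' sym coercive ode_y _ _ \<open>y 0 = 0\<close> \<open>norm (x' 0 - g' 0) \<le> C + G\<close> t]
  have "norm (y t) ^ 2 \<le> eps * C * \<Lambda>" "norm (x' t - g' t) ^ 2 \<le> \<Lambda>"
    unfolding \<Lambda>_def using M' g by (auto intro!: energy)
  moreover have "vector_derivative y (at t within {0..T}) = x' t - g' t"
    using vector_derivative_within_closed_interval[OF \<open>T > 0\<close> t y[OF t]] .
  ultimately show "norm (x t - matrix_inv (M t) *v v t) \<le> sqrt (C * \<Lambda>) * sqrt eps"
    and "norm (vector_derivative (\<lambda>s. x s - matrix_inv (M s) *v v s) (at t within {0..T})) \<le> sqrt \<Lambda>"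
    unfolding y_def[abs_def] g_def[abs_def]
    by (auto simp: real_le_rsqrt real_sqrt_mult[symmetric] mult_ac)
qed

theorem lemma3p2:
  fixes F :: "real^'d \<Rightarrow> real^'d"
    and A :: "real^'d \<Rightarrow> real^'m^'m"
    and b :: "real^'d \<Rightarrow> real^'m"
    and tf C :: real
    and r r1 r2 r3 :: "real \<Rightarrow> real \<Rightarrow> real^'d"
    and x x1 x2 x3 :: "real \<Rightarrow> real \<Rightarrow> real^'m"
  assumes tf_pos: "tf > 0"
    and C_pos: "C > 0"
    and F_C2: "Ck 2 F"
    and A_C3: "Ck 3 A"
    and b_C3: "Ck 3 b"
    and A_sym: "\<And>\<rho>. transpose (A \<rho>) = A \<rho>"
    and A_coercive: "\<And>\<rho> v. v \<bullet> (A \<rho> *v v) \<ge> (1 / C) * norm v ^ 2"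
    (* r(eps,.) and x(eps,.) are C^3 on [0,tf], with derivatives r1,r2,r3 and x1,x2,x3 *)
    and r_d1: "\<And>eps t. eps > 0 \<Longrightarrow> t \<in> {0..tf} \<Longrightarrow>
        (r eps has_vector_derivative r1 eps t) (at t within {0..tf})"
    and r_d2: "\<And>eps t. eps > 0 \<Longrightarrow> t \<in> {0..tf} \<Longrightarrow>
        (r1 eps has_vector_derivative r2 eps t) (at t within {0..tf})"
    and r_d3: "\<And>eps t. eps > 0 \<Longrightarrow> t \<in> {0..tf} \<Longrightarrow>
        (r2 eps has_vector_derivative r3 eps t) (at t within {0..tf})"
    and r3_cont: "\<And>eps. eps > 0 \<Longrightarrow> continuous_on {0..tf} (r3 eps)"
    and x_d1: "\<And>eps t. eps > 0 \<Longrightarrow> t \<in> {0..tf} \<Longrightarrow>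
        (x eps has_vector_derivative x1 eps t) (at t within {0..tf})"
    and x_d2: "\<And>eps t. eps > 0 \<Longrightarrow> t \<in> {0..tf} \<Longrightarrow>
        (x1 eps has_vector_derivative x2 eps t) (at t within {0..tf})"
    and x_d3: "\<And>eps t. eps > 0 \<Longrightarrow> t \<in> {0..tf} \<Longrightarrow>
        (x2 eps has_vector_derivative x3 eps t) (at t within {0..tf})"
    and x3_cont: "\<And>eps. eps > 0 \<Longrightarrow> continuous_on {0..tf} (x3 eps)"
    (* the XLMD system *)
    and ode_r: "\<And>eps t. eps > 0 \<Longrightarrow> t \<in> {0..tf} \<Longrightarrow>
        r2 eps t = F (r eps t) - gradQ_r A b (r eps t) (x eps t)"
    and ode_x: "\<And>eps t. eps > 0 \<Longrightarrow> t \<in> {0..tf} \<Longrightarrow>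
        eps *\<^sub>R x2 eps t = b (r eps t) - A (r eps t) *v x eps t"
    (* uniform bounds *)
    and bnd: "\<And>eps t. eps > 0 \<Longrightarrow> t \<in> {0..tf} \<Longrightarrow>
        norm (r eps t) \<le> C \<and> norm (r1 eps t) \<le> C \<and> norm (r2 eps t) \<le> C \<and>
        norm (x eps t) \<le> C \<and> sqrt eps * norm (x1 eps t) \<le> C"
    (* compatible initial conditions *)
    and init_x: "\<And>eps. eps > 0 \<Longrightarrow>
        x eps 0 = matrix_inv (A (r eps 0)) *v b (r eps 0)"
    and init_bnd: "\<And>eps. eps > 0 \<Longrightarrow>
        norm (x1 eps 0) \<le> C \<and> norm (r eps 0) \<le> C \<and> norm (r1 eps 0) \<le> C"
  shows "\<exists>K. \<forall>eps>0. \<forall>t\<in>{0..tf}.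
     (let y = (\<lambda>s. x eps s - matrix_inv (A (r eps s)) *v b (r eps s)) in
        norm (y t) \<le> K * sqrt eps \<and>
        norm (vector_derivative y (at t within {0..tf})) \<le> K)"
proof -
  have "Ck 2 A" "Ck 2 b"
    using A_C3 b_C3 Ck_Suc_imp_Ck[of 2] by (simp_all only: eval_nat_numeral(3))
  obtain KA where
    KA: "\<And>\<rho> S. bounded_twice_differentiable_on S C \<rho> \<Longrightarrow> bounded_twice_differentiable_on S KA (\<lambda>s. A (\<rho> s))"
    using bounded_twice_differentiable_on_Ck2_comp[OF \<open>Ck 2 A\<close>] by blast
  obtain Kb where
    Kb: "\<And>\<rho> S. bounded_twice_differentiable_on S C \<rho> \<Longrightarrow> bounded_twice_differentiable_on S Kb (\<lambda>s. b (\<rho> s))"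
    using bounded_twice_differentiable_on_Ck2_comp[OF \<open>Ck 2 b\<close>] by blast
  define K where "K = max KA Kb"
  define G where "G = C * K * (1 + C * K) * (1 + 2 * (C * K))"
  define \<Lambda> where "\<Lambda> = exp ((1 + K * C) * tf) * ((C + G) ^ 2 + G ^ 2)"
  have "let y = \<lambda>s. x eps s - matrix_inv (A (r eps s)) *v b (r eps s) in
      norm (y t) \<le> max (sqrt (C * \<Lambda>)) (sqrt \<Lambda>) * sqrt eps \<and>
      norm (vector_derivative y (at t within {0..tf})) \<le> max (sqrt (C * \<Lambda>)) (sqrt \<Lambda>)"
    if "eps > 0" "t \<in> {0..tf}" for eps t
  proof -
    have "bounded_twice_differentiable_on {0..tf} C (r eps)"
      unfolding bounded_twice_differentiable_on_def using r_d1 r_d2 bnd \<open>eps > 0\<close> by blast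
    then have A_r: "bounded_twice_differentiable_on {0..tf} K (\<lambda>s. A (r eps s))"
      and b_r: "bounded_twice_differentiable_on {0..tf} K (\<lambda>s. b (r eps s))"
      using KA Kb bounded_twice_differentiable_on_mono unfolding K_def by (meson max.cobounded1 max.cobounded2)+
    have "bounded_twice_differentiable_on {0..tf} G (\<lambda>s. matrix_inv (A (r eps s)) *v b (r eps s))"
      using bounded_twice_differentiable_on_matrix_inv_mult[of "1 / C", OF _ _ A_r b_r]
        coercive_imp_bounded_below[OF A_coercive] C_pos
      unfolding G_def by (simp add: mult.commute)
    note deviation = quasi_static_deviation[OF tf_pos \<open>eps > 0\<close> C_pos A_sym A_coercive A_r this
        x_d1[OF \<open>eps > 0\<close>] x_d2[OF \<open>eps > 0\<close>] ode_x[OF \<open>eps > 0\<close>] init_x[OF \<open>eps > 0\<close>]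
        init_bnd[OF \<open>eps > 0\<close>, THEN conjunct1] \<open>t \<in> {0..tf}\<close>, folded \<Lambda>_def]
    have "sqrt (C * \<Lambda>) * sqrt eps \<le> max (sqrt (C * \<Lambda>)) (sqrt \<Lambda>) * sqrt eps"
      by (rule mult_right_mono) (use \<open>eps > 0\<close> in simp_all)
    then show ?thesis
      using deviation unfolding Let_def by linarith
  qed
  then show ?thesis
    by blast
qed

end
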